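(* Let $\omega\in\mathbb{C}$ belong to the strip $|\operatorname{Im}\omega|\leq C$ where $C$ is a positive number. Suppose that $\max_{\overline{\mathbf{S}}}|C_{f}(x,t)-C_N(x,t)|\leq\varepsilon$. Then for every $x\in[0,b]$ $$|c(\omega,x;h)-c_{N}(\omega,x)|\leq \varepsilon\,\frac{\sinh (Cx)}{C}.$$
   Context: Setting. Let $b>0$, let $q:[-b,b]\to\mathbb{C}$ be continuous, and let $f\in C^{2}[-b,b]$ be a complex-valued solution of $f''-qf=0$ with $f(x)\neq 0$ on $[-b,b]$ and $f(0)=1$. Put $h:=f'(0)\in\mathbb{C}$. Let $\overline{\mathbf{S}}=[-b,b]\times[-b,b]$ in the $(x,t)$-plane. Kernel: $\mathbf{K}_{f}(x,t)=\mathbf{H}\bigl(\tfrac{x+t}{2},\tfrac{x-t}{2}\bigr)$ for $(x,t)\in\overline{\mathbf{S}}$, where $\mathbf{H}$ is the unique solution of the Goursat problem $\frac{\partial^{2}\mathbf{H}(u,v)}{\partial u\,\partial v}=q(u+v)\mathbf{H}(u,v)$, $\mathbf{H}(u,0)=\frac h2+\frac12\int_0^u q(s)\,ds$, $\mathbf{H}(0,v)=\frac h2$. Put $C_f(x,t)=\mathbf{K}_f(x,t)+\mathbf{K}_f(x,-t)$. $c(\omega,x;h)$ denotes the solution of $u''-q(x)u+\omega^2u=0$ with $c(\omega,0;h)=1$, $c'_x(\omega,0;h)=h$. It is known that $c(\omega,x;h)=\cos\omega x+\int_0^x C_f(x,t)\cos\omega t\,dt$. Recursive integrals: $X^{(0)}\equiv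 \widetilde X^{(0)}\equiv 1$ and, for $n\ge 1$, $X^{(n)}(x)=n\int_{0}^{x}X^{(n-1)}(s)(f^{2}(s))^{(-1)^{n}}ds$, $\widetilde X^{(n)}(x)=n\int_{0}^{x}\widetilde X^{(n-1)}(s)(f^{2}(s))^{(-1)^{n-1}}ds$. Put $\varphi_k=fX^{(k)}$ for $k$ odd and $\varphi_k=f\widetilde X^{(k)}$ for $k$ even; $u_0(x,t)=\varphi_0(x)$ and $u_{2n-1}(x,t)=\sum_{0\le k\le n,\ k\text{ even}}\binom nk\varphi_{n-k}(x)t^k$ for $n\ge1$. For $N\in\mathbb{N}$ and given complex coefficients $a_0,\dots,a_N$, $$C_N(x,t)=2\Bigl(a_0u_0(x,t)+\sum_{n=1}^N a_nu_{2n-1}(x,t)\Bigr),\qquad c_N(\omega,x)=\cos\omega x+\int_0^x C_N(x,t)\cos\omega t\,dt .$$ *)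

theory Defs
  imports "HOL-Analysis.Analysis"
begin

text \<open>Oriented integrals from \<open>0\<close> to \<open>x\<close>, where \<open>x\<close> may be negative, are written \<open>LBINT s=0..x\<close>.\<close>

text \<open>\<open>y\<close> is a twice continuously differentiable solution of
  \<open>y'' - q y + \<mu> y = 0\<close> on \<open>[-b,b]\<close>, with one-sided derivatives at the end points.\<close>

definition schroedinger_solution ::
  "real \<Rightarrow> (real \<Rightarrow> complex) \<Rightarrow> complex \<Rightarrow> (real \<Rightarrow> complex) \<Rightarrow> bool" where
  "schroedinger_solution b q \<mu> y \<longleftrightarrow>
     (\<exists>y' y''.
        (\<forall>x\<in>{-b..b}. (y has_vector_derivative y' x) (at x within {-b..b})) \<and>
        (\<forall>x\<in>{-b..b}. (y' has_vector_derivative y'' x) (at x within {-b..b})) \<and>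
        continuous_on {-b..b} y'' \<and>
        (\<forall>x\<in>{-b..b}. y'' x - q x * y x + \<mu> * y x = 0))"

text \<open>The image of \<open>[-b,b] \<times> [-b,b]\<close> under \<open>(x,t) \<mapsto> ((x+t)/2, (x-t)/2)\<close>.\<close>

definition goursat_domain :: "real \<Rightarrow> (real \<times> real) set" where
  "goursat_domain b = {(u, v). \<bar>u + v\<bar> \<le> b \<and> \<bar>u - v\<bar> \<le> b}"

text \<open>\<open>Hv\<close> is the partial derivative of \<open>H\<close> in its second argument. Partial derivatives are
  taken along the sections of the domain, hence one-sided at the boundary. At a corner one of
  the two sections is a single point, and the derivative condition along it is void; on the
  domain the solution is still unique, since \<open>H\<close> is continuous.\<close>

definition goursat_solution ::
  "real \<Rightarrow> (real \<Rightarrow> complex) \<Rightarrow> complex \<Rightarrow> (real \<Rightarrow> real \<Rightarrow> complex) \<Rightarrow> bool" where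
  "goursat_solution b q h H \<longleftrightarrow>
     continuous_on (goursat_domain b) (\<lambda>(u, v). H u v) \<and>
     (\<exists>Hv. \<forall>(u, v)\<in>goursat_domain b.
        ((\<lambda>r. H u r) has_vector_derivative Hv u v)
          (at v within {r. (u, r) \<in> goursat_domain b}) \<and>
        ((\<lambda>s. Hv s v) has_vector_derivative q (u + v) * H u v)
          (at u within {s. (s, v) \<in> goursat_domain b})) \<and>
     (\<forall>u\<in>{-b..b}. H u 0 = h / 2 + 1 / 2 * (LBINT s=0..u. q s)) \<and>
     (\<forall>v\<in>{-b..b}. H 0 v = h / 2)"

definition kernel_K :: "(real \<Rightarrow> real \<Rightarrow> complex) \<Rightarrow> real \<Rightarrow> real \<Rightarrow> complex" where
  "kernel_K H x t = H ((x + t) / 2) ((x - t) / 2)"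

definition kernel_C :: "(real \<Rightarrow> real \<Rightarrow> complex) \<Rightarrow> real \<Rightarrow> real \<Rightarrow> complex" where
  "kernel_C H x t = kernel_K H x t + kernel_K H x (- t)"

primrec rec_X :: "(real \<Rightarrow> complex) \<Rightarrow> nat \<Rightarrow> real \<Rightarrow> complex" where
  "rec_X f 0 x = 1"
| "rec_X f (Suc n) x =
     of_nat (Suc n) * (LBINT s=0..x. rec_X f n s * ((f s)\<^sup>2) powi ((-1) ^ Suc n))"

primrec rec_Xt :: "(real \<Rightarrow> complex) \<Rightarrow> nat \<Rightarrow> real \<Rightarrow> complex" where
  "rec_Xt f 0 x = 1"
| "rec_Xt f (Suc n) x =
     of_nat (Suc n) * (LBINT s=0..x. rec_Xt f n s * ((f s)\<^sup>2) powi ((-1) ^ n))"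

definition formal_power :: "(real \<Rightarrow> complex) \<Rightarrow> nat \<Rightarrow> real \<Rightarrow> complex" where
  "formal_power f k x = f x * (if odd k then rec_X f k x else rec_Xt f k x)"

definition wave_poly_0 :: "(real \<Rightarrow> complex) \<Rightarrow> real \<Rightarrow> real \<Rightarrow> complex" where
  "wave_poly_0 f x t = formal_power f 0 x"

text \<open>\<open>wave_poly_odd f n\<close> is \<open>u\<^bsub>2n-1\<^esub>\<close>, for \<open>n \<ge> 1\<close>.\<close>

definition wave_poly_odd :: "(real \<Rightarrow> complex) \<Rightarrow> nat \<Rightarrow> real \<Rightarrow> real \<Rightarrow> complex" where
  "wave_poly_odd f n x t =
     (\<Sum>k | k \<le> n \<and> even k. of_nat (n choose k) * formal_power f (n - k) x * of_real t ^ k)"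

definition approx_C ::
  "(real \<Rightarrow> complex) \<Rightarrow> (nat \<Rightarrow> complex) \<Rightarrow> nat \<Rightarrow> real \<Rightarrow> real \<Rightarrow> complex" where
  "approx_C f a N x t =
     2 * (a 0 * wave_poly_0 f x t + (\<Sum>n=1..N. a n * wave_poly_odd f n x t))"

definition approx_c ::
  "(real \<Rightarrow> complex) \<Rightarrow> (nat \<Rightarrow> complex) \<Rightarrow> nat \<Rightarrow> complex \<Rightarrow> real \<Rightarrow> complex" where
  "approx_c f a N \<omega> x =
     cos (\<omega> * of_real x) + (LBINT t=0..x. approx_C f a N x t * cos (\<omega> * of_real t))"

end

theory Submission
  imports Defs
begin

text \<open>Substituting the integral equation of the Goursat problem into
  \<open>y(x) = cos \<omega>x + \<integral>\<^sub>0\<^sup>x C\<^sub>f(x,t) cos \<omega>t dt = cos \<omega>x + 2 \<integral>\<^sub>0\<^sup>x H(x-v,v) cos \<omega>(x-2v) dv\<close>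
  and exchanging the order of integration, the inner integral of \<open>cos \<omega>(x-2v)\<close> over
  \<open>[r, x-s]\<close> is \<open>S(x-r-s) cos \<omega>(s-r)\<close> with \<open>S(z) = sin(\<omega>z)/\<omega>\<close>, so that \<open>y\<close> satisfies the
  Volterra equation \<open>y(x) = cos \<omega>x + h S(x) + \<integral>\<^sub>0\<^sup>x S(x-s) q(s) y(s) ds\<close>. The function \<open>c\<close> satisfies
  the same equation, hence \<open>c = y\<close>. No second derivative of \<open>y\<close> is needed, which matters because
  \<open>q\<close> is only continuous. The error is then \<open>\<integral>\<^sub>0\<^sup>x (C\<^sub>f - C\<^sub>N) cos \<omega>t dt\<close>, and
  \<open>|cos \<omega>t| \<le> cosh(Ct)\<close> in the strip.\<close>

section \<open>Exchange of the order of integration over planar regions\<close>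

text \<open>A bounded region has finite planar measure, so a function bounded on it is integrable
  there and Fubini applies. Carrying the region as an indicator lets one statement serve triangles
  of every shape.\<close>

lemma lborel_integral_swap_bounded:
  fixes g :: "real \<Rightarrow> real \<Rightarrow> complex"
  assumes g [measurable]: "(\<lambda>(v, s). g v s) \<in> borel_measurable (lborel \<Otimes>\<^sub>M lborel)"
    and A [measurable]: "A \<in> sets (lborel \<Otimes>\<^sub>M lborel)"
    and AK: "A \<subseteq> {c..d} \<times> {c..d}"
    and B: "\<And>v s. (v, s) \<in> A \<Longrightarrow> norm (g v s) \<le> B"
  shows "(LBINT v. LBINT s. indicator A (v, s) *\<^sub>R g v s)
       = (LBINT s. LBINT v. indicator A (v, s) *\<^sub>R g v s)"
proof (rule lborel_pair.Fubini_integral[symmetric])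
  have "emeasure (lborel \<Otimes>\<^sub>M lborel) A
      \<le> emeasure (lborel \<Otimes>\<^sub>M lborel) ({c..d::real} \<times> {c..d::real})"
    using AK by (rule emeasure_mono) auto
  also have "\<dots> = emeasure lborel {c..d} * emeasure lborel {c..d}"
    by (rule lborel.emeasure_pair_measure_Times) auto
  also have "\<dots> < \<infinity>"
    by (simp add: emeasure_lborel_Icc_eq ennreal_mult_less_top)
  finally have "emeasure (lborel \<Otimes>\<^sub>M lborel) A < \<infinity>" .
  then have "integrable (lborel \<Otimes>\<^sub>M lborel) (\<lambda>p. indicator A p *\<^sub>R (\<lambda>(v, s). g v s) p)"
    by (intro integrableI_bounded_set_indicator[OF A g, where B=B]) (auto intro!: AE_I2 B)
  then show "integrable (lborel \<Otimes>\<^sub>M lborel) (\<lambda>(v, s). indicator A (v, s) *\<^sub>R g v s)"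
    by (simp add: case_prod_beta')
qed

lemma set_integral_swap_triangle_le:
  fixes g :: "real \<Rightarrow> real \<Rightarrow> complex"
  assumes g: "(\<lambda>(z, r). g z r) \<in> borel_measurable (lborel \<Otimes>\<^sub>M lborel)"
    and B: "\<And>z r. 0 \<le> r \<Longrightarrow> r \<le> z \<Longrightarrow> z \<le> x \<Longrightarrow> norm (g z r) \<le> B"
  shows "(LBINT z:{0..x}. LBINT r:{0..z}. g z r) = (LBINT r:{0..x}. LBINT z:{r..x}. g z r)"
proof -
  define A where "A = {(z, r). 0 \<le> r \<and> r \<le> z \<and> z \<le> (x::real)}"
  have m: "A \<in> sets (lborel \<Otimes>\<^sub>M lborel)"
  proof -
    have "{p \<in> space (lborel \<Otimes>\<^sub>M lborel). 0 \<le> snd p \<and> snd p \<le> fst p \<and> fst p \<le> x}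
        \<in> sets (lborel \<Otimes>\<^sub>M lborel)" by measurable
    then show ?thesis by (simp add: A_def space_pair_measure case_prod_beta')
  qed
  have "(LBINT z:{0..x}. LBINT r:{0..z}. g z r) = (LBINT z. LBINT r. indicator A (z, r) *\<^sub>R g z r)"
    unfolding set_lebesgue_integral_def integral_scaleR_right[symmetric]
    by (intro Bochner_Integration.integral_cong refl) (auto simp: A_def indicator_def)
  also have "\<dots> = (LBINT r. LBINT z. indicator A (z, r) *\<^sub>R g z r)"
    by (rule lborel_integral_swap_bounded[OF g m, where c=0 and d=x and B=B]) (auto simp: A_def B)
  also have "\<dots> = (LBINT r:{0..x}. LBINT z:{r..x}. g z r)"
    unfolding set_lebesgue_integral_def integral_scaleR_right[symmetric]
    by (intro Bochner_Integration.integral_cong refl) (auto simp: A_def indicator_def)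
  finally show ?thesis .
qed

text \<open>The free lower limit \<open>a\<close> serves the triple integral of the Goursat kernel,
  where \<open>v\<close> starts at \<open>r\<close> after a first exchange.\<close>

lemma set_integral_swap_triangle_sum_le:
  fixes g :: "real \<Rightarrow> real \<Rightarrow> complex"
  assumes g: "(\<lambda>(v, s). g v s) \<in> borel_measurable (lborel \<Otimes>\<^sub>M lborel)"
    and a: "0 \<le> a"
    and B: "\<And>v s. a \<le> v \<Longrightarrow> 0 \<le> s \<Longrightarrow> v + s \<le> x \<Longrightarrow> norm (g v s) \<le> B"
  shows "(LBINT v:{a..x}. LBINT s:{0..x - v}. g v s) = (LBINT s:{0..x - a}. LBINT v:{a..x - s}. g v s)"
proof -
  define A where "A = {(v, s). a \<le> v \<and> 0 \<le> s \<and> v + s \<le> (x::real)}"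
  have m: "A \<in> sets (lborel \<Otimes>\<^sub>M lborel)"
  proof -
    have "{p \<in> space (lborel \<Otimes>\<^sub>M lborel). a \<le> fst p \<and> 0 \<le> snd p \<and> fst p + snd p \<le> x}
        \<in> sets (lborel \<Otimes>\<^sub>M lborel)" by measurable
    then show ?thesis by (simp add: A_def space_pair_measure case_prod_beta')
  qed
  have "(LBINT v:{a..x}. LBINT s:{0..x - v}. g v s) = (LBINT v. LBINT s. indicator A (v, s) *\<^sub>R g v s)"
    unfolding set_lebesgue_integral_def integral_scaleR_right[symmetric]
    by (intro Bochner_Integration.integral_cong refl) (auto simp: A_def indicator_def)
  also have "\<dots> = (LBINT s. LBINT v. indicator A (v, s) *\<^sub>R g v s)"
    using a by (intro lborel_integral_swap_bounded[OF g m, where c=0 and d=x and B=B]) (auto simp: A_def B)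
  also have "\<dots> = (LBINT s:{0..x - a}. LBINT v:{a..x - s}. g v s)"
    unfolding set_lebesgue_integral_def integral_scaleR_right[symmetric]
    by (intro Bochner_Integration.integral_cong refl) (auto simp: A_def indicator_def)
  finally show ?thesis .
qed

lemma set_integral_shift:
  fixes g :: "real \<Rightarrow> complex"
  shows "(LBINT s:{0..x - r}. g s) = (LBINT z:{r..x}. g (z - r))"
  unfolding set_lebesgue_integral_def
  by (subst lborel_integral_real_affine[where c=1 and t="- r"])
     (auto intro!: Bochner_Integration.integral_cong simp: indicator_def)

lemma interval_integral_0_Icc [simp]:
  fixes f :: "real \<Rightarrow> 'a::{banach, second_countable_topology}"
  shows "0 \<le> x \<Longrightarrow> (LBINT t=0..ereal x. f t) = (LBINT t:{0..x}. f t)"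
  using interval_integral_Icc[of 0 x f] by (simp add: zero_ereal_def)

section \<open>The sine kernel and its trigonometric integrals\<close>

text \<open>This is the solution of \<open>S'' + \<omega>\<^sup>2 S = 0\<close> with
  \<open>S(0) = 0\<close> and \<open>S'(0) = 1\<close>. The case \<open>\<omega> = 0\<close> is its
  limit, since the quotient would otherwise collapse to 0 by the convention for division by
  zero.\<close>

definition sine_kernel :: "complex \<Rightarrow> complex \<Rightarrow> complex" where
  "sine_kernel \<omega> z = (if \<omega> = 0 then z else sin (\<omega> * z) / \<omega>)"

lemma sine_kernel_0 [simp]: "sine_kernel \<omega> 0 = 0"
  by (simp add: sine_kernel_def)

lemma sine_kernel_minus [simp]: "sine_kernel \<omega> (- z) = - sine_kernel \<omega> z"
  by (simp add: sine_kernel_def)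

lemma has_field_derivative_sine_kernel:
  "(sine_kernel \<omega> has_field_derivative cos (\<omega> * z)) (at z)"
proof (cases "\<omega> = 0")
  case True
  then have "sine_kernel \<omega> = (\<lambda>z. z)" by (auto simp: sine_kernel_def)
  with True show ?thesis by simp
next
  case False
  then have "sine_kernel \<omega> = (\<lambda>z. sin (\<omega> * z) / \<omega>)" by (auto simp: sine_kernel_def)
  with False show ?thesis by (auto intro!: derivative_eq_intros)
qed

lemma continuous_on_sine_kernel [continuous_intros]:
  "continuous_on S g \<Longrightarrow> continuous_on S (\<lambda>x. sine_kernel \<omega> (g x))"
  by (rule continuous_on_compose2[of UNIV])
     (auto intro!: continuous_at_imp_continuous_on DERIV_isCont has_field_derivative_sine_kernel)

lemma measurable_sine_kernel [measurable]: "sine_kernel \<omega> \<in> borel_measurable borel"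
  by (rule borel_measurable_continuous_onI) (auto intro: continuous_intros)

lemma sine_kernel_add_minus:
  "sine_kernel \<omega> (s + t) + sine_kernel \<omega> (s - t) = 2 * (sine_kernel \<omega> s * cos (\<omega> * t))"
  by (auto simp: sine_kernel_def sin_add sin_diff field_simps)

text \<open>Variation of constants: the derivative of the sine kernel is the cosine, so the two
  terms in \<open>y'\<close> cancel, and the derivative of the cosine factor contributes the term
  with \<open>\<omega>\<^sup>2\<close>.\<close>

lemma sine_kernel_Volterra_derivative:
  assumes "(y has_vector_derivative y' s) (at s within A)" "(y' has_vector_derivative d) (at s within A)"
  shows "((\<lambda>s. sine_kernel \<omega> (of_real (x - s)) * y' s + cos (\<omega> * of_real (x - s)) * y s)
     has_vector_derivative sine_kernel \<omega> (of_real (x - s)) * (d + \<omega>\<^sup>2 * y s)) (at s within A)"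
proof -
  have g: "((\<lambda>s. of_real (x - s) :: complex) has_vector_derivative - 1) (at s within A)"
    by (auto intro!: derivative_eq_intros)
  have 1: "((\<lambda>s. sine_kernel \<omega> (of_real (x - s))) has_vector_derivative - cos (\<omega> * of_real (x - s))) (at s within A)"
    using field_vector_diff_chain_within[OF g has_field_derivative_at_within[OF has_field_derivative_sine_kernel]]
    by (simp add: o_def)
  have "((\<lambda>z. cos (\<omega> * z)) has_field_derivative - \<omega>\<^sup>2 * sine_kernel \<omega> z) (at z)" for z
    by (auto intro!: derivative_eq_intros simp: sine_kernel_def power2_eq_square)
  note 2 = field_vector_diff_chain_within[OF g has_field_derivative_at_within[OF this]]
  from has_vector_derivative_add[OF has_vector_derivative_mult[OF 1 assms(2)]
      has_vector_derivative_mult[OF 2[unfolded o_def] assms(1)]]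
  show ?thesis by (rule has_vector_derivative_eq_rhs) (simp add: algebra_simps)
qed

text \<open>The end point values of the antiderivative combine by the sum-to-product formula. The
  first factor of the result depends on \<open>r\<close> and \<open>s\<close> only through
  \<open>r + s\<close>, which is also the argument of \<open>q\<close> in the Goursat equation; this
  is what later lets both factors leave the inner integral.\<close>

lemma interval_integral_cos_chord:
  "(LBINT v=ereal r..ereal (x - s). cos (\<omega> * of_real (x - 2 * v)))
     = sine_kernel \<omega> (of_real (x - r - s)) * cos (\<omega> * of_real (s - r))"
proof -
  define F where "F v = - (1/2) * sine_kernel \<omega> (of_real (x - 2 * v))" for v
  have "(LBINT v=ereal r..ereal (x - s). cos (\<omega> * of_real (x - 2 * v))) = F (x - s) - F r"
  proof (rule interval_integral_FTC_finite)
    fix v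
    let ?A = "{min r (x - s)..max r (x - s)}"
    have g: "((\<lambda>v. of_real (x - 2 * v) :: complex) has_vector_derivative - 2) (at v within ?A)"
      by (auto intro!: derivative_eq_intros)
    have "((\<lambda>v. sine_kernel \<omega> (of_real (x - 2 * v))) has_vector_derivative
        - 2 * cos (\<omega> * of_real (x - 2 * v))) (at v within ?A)"
      using field_vector_diff_chain_within[OF g has_field_derivative_at_within[OF has_field_derivative_sine_kernel]]
      by (simp add: o_def)
    from has_vector_derivative_mult_right[OF this, of "- (1/2)"]
    show "(F has_vector_derivative cos (\<omega> * of_real (x - 2 * v))) (at v within ?A)"
      by (simp add: F_def[abs_def])
  qed (auto intro!: continuous_intros)
  also have "\<dots> = (sine_kernel \<omega> (of_real (x - 2 * r)) - sine_kernel \<omega> (of_real (2 * s - x))) / 2"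
    using sine_kernel_minus[of \<omega> "of_real (2 * s - x)"] by (simp add: F_def field_simps)
  also have "\<dots> = sine_kernel \<omega> (of_real (x - r - s)) * cos (\<omega> * of_real (s - r))"
    using sine_kernel_add_minus[of \<omega> "of_real (x - r - s)" "of_real (s - r)"]
      sine_kernel_minus[of \<omega> "of_real (2 * s - x)"]
    by (simp add: algebra_simps flip: mult_2)
  finally show ?thesis .
qed

section \<open>Uniqueness for Volterra equations with bounded kernel\<close>

lemma Volterra_uniqueness:
  fixes d k :: "real \<Rightarrow> complex"
  assumes b: "0 \<le> b" and d: "continuous_on {0..b} d"
    and K: "\<And>x s. 0 \<le> s \<Longrightarrow> s \<le> x \<Longrightarrow> x \<le> b \<Longrightarrow> norm (K x s) \<le> M"
    and eq: "\<And>x. x \<in> {0..b} \<Longrightarrow> d x = (LBINT s:{0..x}. K x s * d s)"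
    and x: "x \<in> {0..b}"
  shows "d x = 0"
proof -
  \<comment> \<open>In the norm weighted by \<open>exp (-2Lx)\<close> the Volterra operator has norm at most \<open>1/2\<close>.\<close>
  define L where "L = max M 1"
  have L: "L > 0" "M \<le> L" by (auto simp: L_def)
  define w where "w x = norm (d x) * exp (- 2 * L * x)" for x
  have "continuous_on {0..b} w" unfolding w_def by (intro continuous_intros d)
  then obtain p where p: "p \<in> {0..b}" "\<And>x. x \<in> {0..b} \<Longrightarrow> w x \<le> w p"
    using continuous_attains_sup[of "{0..b}" w] b by auto
  have dle: "norm (d s) \<le> w p * exp (2 * L * s)" if "s \<in> {0..b}" for s
    using p(2)[OF that] by (simp add: w_def exp_minus field_simps)
  have wp: "w p \<ge> 0" by (simp add: w_def)
  have FTC: "(LBINT s=ereal 0..ereal p. L * (w p * exp (2 * L * s))) = w p * exp (2 * L * p) / 2 - w p * exp (2 * L * 0) / 2"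
    using L by (intro interval_integral_FTC_finite)
      (auto intro!: continuous_intros derivative_eq_intros simp flip: has_real_derivative_iff_has_vector_derivative)
  have "norm (d p) = norm (LBINT s:{0..p}. K p s * d s)"
    using eq[OF p(1)] by simp
  also have "\<dots> \<le> (LBINT s:{0..p}. L * (w p * exp (2 * L * s)))"
  proof -
    have "norm (LBINT s:{0..p}. K p s * d s) \<le> (LBINT s. norm (indicator {0..p} s *\<^sub>R (K p s * d s)))"
      unfolding set_lebesgue_integral_def by (rule integral_norm_bound)
    \<comment> \<open>\<open>K\<close> is only assumed bounded, so the integrand may fail to be
      integrable; its integral is then 0 by convention, which the nonnegative majorant
      covers.\<close>
    also have "\<dots> \<le> (LBINT s:{0..p}. L * (w p * exp (2 * L * s)))"
      unfolding set_lebesgue_integral_def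
    proof (rule integral_mono')
      show "integrable lborel (\<lambda>s. indicator {0..p} s *\<^sub>R (L * (w p * exp (2 * L * s))))"
        by (intro borel_integrable_compact compact_Icc continuous_intros)
    next
      fix s
      show "0 \<le> indicator {0..p} s *\<^sub>R (L * (w p * exp (2 * L * s)))"
        using L wp by (simp add: indicator_def)
      show "norm (indicator {0..p} s *\<^sub>R (K p s * d s)) \<le> indicator {0..p} s *\<^sub>R (L * (w p * exp (2 * L * s)))"
      proof (cases "s \<in> {0..p}")
        case True
        then have "norm (K p s) \<le> L" using K[of s p] p L by auto
        then have "norm (K p s) * norm (d s) \<le> L * (w p * exp (2 * L * s))"
          using True p L by (intro mult_mono dle) auto
        with True show ?thesis by (simp add: norm_mult)
      qed simp
    qed
    finally show ?thesis .
  qed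
  also have "\<dots> = (LBINT s=ereal 0..ereal p. L * (w p * exp (2 * L * s)))"
    using p by (simp add: interval_integral_Icc)
  also have "\<dots> \<le> w p * exp (2 * L * p) / 2" unfolding FTC using wp by simp
  \<comment> \<open>Multiplying by \<open>exp (- 2 * L * p)\<close> turns the estimate at the
    maximiser \<open>p\<close> into a contraction by 1/2, so the maximum of \<open>w\<close> is
    0.\<close>
  finally have "w p \<le> w p / 2"
    by (simp add: w_def exp_minus field_simps)
  then have "w x \<le> 0" using p(2)[OF x] wp by simp
  then show ?thesis by (simp add: w_def mult_le_0_iff)
qed

section \<open>The Goursat problem as an integral equation\<close>

text \<open>For \<open>x\<close> in \<open>[0,b]\<close> and \<open>|t| <= x\<close> the
  characteristic coordinates \<open>(x+t)/2\<close> and \<open>(x-t)/2\<close> are nonnegative with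
  sum \<open>x\<close>, so the kernel is integrated over this triangle only.\<close>

lemma goursat_domainI:
  "0 \<le> u \<Longrightarrow> 0 \<le> v \<Longrightarrow> u + v \<le> b \<Longrightarrow> (u, v) \<in> goursat_domain b"
  by (auto simp: goursat_domain_def)

lemma goursat_solution_continuous_on:
  assumes "goursat_solution b q h H"
    and "continuous_on S u" "continuous_on S v"
    and "\<And>p. p \<in> S \<Longrightarrow> (u p, v p) \<in> goursat_domain b"
  shows "continuous_on S (\<lambda>p. H (u p) (v p))"
proof -
  have "continuous_on (goursat_domain b) (\<lambda>(u, v). H u v)"
    using assms(1) by (simp add: goursat_solution_def)
  from continuous_on_compose2[OF this, of S "\<lambda>p. (u p, v p)"] assms(2-4)
  show ?thesis by (auto intro!: continuous_on_Pair)
qed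

text \<open>The mixed derivative is integrated first in \<open>u\<close>, starting from the axis
  \<open>u = 0\<close> where \<open>Hv\<close> vanishes, and then in \<open>v\<close>, starting from
  the prescribed values on \<open>v = 0\<close>.\<close>

lemma goursat_solution_integral_equation:
  assumes b: "b > 0" and q: "continuous_on {-b..b} q" and H: "goursat_solution b q h H"
    and uv: "0 \<le> u" "0 \<le> v" "u + v \<le> b"
  shows "H u v = h / 2 + 1 / 2 * (LBINT s:{0..u}. q s)
    + (LBINT r:{0..v}. LBINT s:{0..u}. q (s + r) * H s r)"
proof -
  from H obtain Hv where
    Hv: "\<And>u v. (u, v) \<in> goursat_domain b \<Longrightarrow>
        ((\<lambda>r. H u r) has_vector_derivative Hv u v) (at v within {r. (u, r) \<in> goursat_domain b})"
      "\<And>u v. (u, v) \<in> goursat_domain b \<Longrightarrow>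
        ((\<lambda>s. Hv s v) has_vector_derivative q (u + v) * H u v)
          (at u within {s. (s, v) \<in> goursat_domain b})"
    and H0: "H u 0 = h / 2 + 1 / 2 * (LBINT s=0..u. q s)"
    and H1: "\<And>v. v \<in> {-b..b} \<Longrightarrow> H 0 v = h / 2"
    using uv unfolding goursat_solution_def by force
  \<comment> \<open>\<open>H\<close> is constant on the axis \<open>u = 0\<close>, whose section is
    all of \<open>[-b,b]\<close>. This interval is nondegenerate, so the derivative along it is
    unique even at the end point \<open>r = b\<close>.\<close>
  have Hv0: "Hv 0 r = 0" if "0 \<le> r" "r \<le> b" for r
  proof -
    have "((\<lambda>r. H 0 r) has_vector_derivative Hv 0 r) (at r within cbox (-b) b)"
      by (rule has_vector_derivative_within_subset[OF Hv(1)]) (use that in \<open>auto simp: goursat_domain_def\<close>)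
    moreover have "((\<lambda>r. H 0 r) has_vector_derivative 0) (at r within cbox (-b) b)"
      by (rule has_vector_derivative_transform[of r _ "\<lambda>r. H 0 r" "\<lambda>_. h / 2"])
         (use that b H1 in auto)
    ultimately show ?thesis
      using b that by (intro vector_derivative_unique_within_closed_interval[of "-b" b r]) auto
  qed
  \<comment> \<open>Stated along arbitrary continuous \<open>w\<close> and \<open>r\<close>, so that
    it covers both a section with \<open>r\<close> fixed and the full rectangle.\<close>
  have qH: "continuous_on S (\<lambda>p. q (w p + r p) * H (w p) (r p))"
    if "continuous_on S w" "continuous_on S r" "\<And>p. p \<in> S \<Longrightarrow> w p \<in> {0..u} \<and> r p \<in> {0..v}"
    for S :: "'x::topological_space set" and w r
    using uv that
    by (intro continuous_on_mult goursat_solution_continuous_on[OF H] continuous_on_compose2[OF q]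
        continuous_on_add) (force intro: goursat_domainI)+
  have Hv_eq: "Hv u r = (LBINT s:{0..u}. q (s + r) * H s r)" if r: "r \<in> {0..v}" for r
  proof -
    have "(LBINT s=ereal 0..ereal u. q (s + r) * H s r) = Hv u r - Hv 0 r"
    proof (rule interval_integral_FTC_finite)
      show "continuous_on {min 0 u..max 0 u} (\<lambda>s. q (s + r) * H s r)"
        using uv r by (intro qH) (auto intro!: continuous_intros)
      show "((\<lambda>s. Hv s r) has_vector_derivative q (s + r) * H s r) (at s within {min 0 u..max 0 u})"
        if "min 0 u \<le> s" "s \<le> max 0 u" for s
        by (rule has_vector_derivative_within_subset[OF Hv(2)]) (use r uv that in \<open>auto intro: goursat_domainI\<close>)
    qed
    then show ?thesis using Hv0[of r] r uv by (simp add: interval_integral_Icc)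
  qed
  have Hv_HK: "Hv u r = integral (cbox 0 u) (\<lambda>s. q (s + r) * H s r)" if r: "r \<in> {0..v}" for r
  proof -
    have "continuous_on {0..u} (\<lambda>s. q (s + r) * H s r)"
      using r by (intro qH) (auto intro!: continuous_intros)
    then show ?thesis
      unfolding Hv_eq[OF r] by (simp add: set_borel_integral_eq_integral borel_integrable_atLeastAtMost')
  qed
  \<comment> \<open>\<open>goursat_solution\<close> does not ask \<open>Hv\<close> to be continuous
    in \<open>v\<close>. Continuity is read off from the integral formula, as an integral depending
    on a parameter, so that the fundamental theorem applies in \<open>v\<close> too.\<close>
  have cont: "continuous_on {0..v} (\<lambda>r. Hv u r)"
  proof -
    have "continuous_on ({0..v} \<times> cbox 0 u) (\<lambda>(r, s). q (s + r) * H s r)"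
      unfolding case_prod_beta' by (rule qH) (auto intro!: continuous_intros)
    from integral_continuous_on_param[OF this] show ?thesis
      by (subst continuous_on_cong[OF refl Hv_HK])
  qed
  have "(LBINT r=ereal 0..ereal v. Hv u r) = H u v - H u 0"
  proof (rule interval_integral_FTC_finite)
    show "continuous_on {min 0 v..max 0 v} (Hv u)" using cont uv by simp
    show "(H u has_vector_derivative Hv u r) (at r within {min 0 v..max 0 v})"
      if "min 0 v \<le> r" "r \<le> max 0 v" for r
      by (rule has_vector_derivative_within_subset[OF Hv(1)]) (use uv that in \<open>auto intro: goursat_domainI\<close>)
  qed
  moreover have "(LBINT r=ereal 0..ereal v. Hv u r) = (LBINT r:{0..v}. LBINT s:{0..u}. q (s + r) * H s r)"
    using uv by (auto simp: interval_integral_Icc Hv_eq intro!: set_lebesgue_integral_cong)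
  moreover have "(LBINT s=0..u. q s) = (LBINT s:{0..u}. q s)"
    using uv by (simp add: interval_integral_Icc zero_ereal_def)
  ultimately show ?thesis using H0 by simp
qed

section \<open>The cosine transform of the kernel and its Volterra equation\<close>

lemma continuous_on_compact_norm_bound:
  fixes f :: "'a::topological_space \<Rightarrow> 'b::real_normed_vector"
  assumes "compact S" "continuous_on S f"
  obtains B where "0 \<le> B" "\<And>x. x \<in> S \<Longrightarrow> norm (f x) \<le> B"
  using compact_imp_bounded[OF compact_continuous_image[OF assms(2,1)]]
  unfolding bounded_pos by (meson imageI less_imp_le)

lemma norm_set_integral_Icc_le:
  fixes f :: "real \<Rightarrow> complex"
  assumes "a \<le> c" "0 \<le> B" and B: "\<And>s. s \<in> {a..c} \<Longrightarrow> norm (f s) \<le> B"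
  shows "norm (LBINT s:{a..c}. f s) \<le> B * (c - a)"
proof -
  have "norm (LBINT s:{a..c}. f s) \<le> (LBINT s. norm (indicator {a..c} s *\<^sub>R f s))"
    unfolding set_lebesgue_integral_def by (rule integral_norm_bound)
  also have "\<dots> \<le> (LBINT s. indicator {a..c} s *\<^sub>R B)"
  proof (rule integral_mono')
    show "integrable lborel (\<lambda>s. indicator {a..c} s *\<^sub>R B)"
      by (intro borel_integrable_compact compact_Icc continuous_intros)
  qed (use assms in \<open>auto simp: indicator_def\<close>)
  also have "\<dots> = B * (c - a)" using \<open>a \<le> c\<close> by simp
  finally show ?thesis .
qed

text \<open>Half of the integral of \<open>C\<^sub>f(x,t) cos(\<omega>t)\<close> over
  \<open>[0,x]\<close>, written in the coordinate \<open>r = (x-t)/2\<close> while \<open>t\<close>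
  runs over \<open>[-x,x]\<close>.\<close>

definition goursat_transform :: "(real \<Rightarrow> real \<Rightarrow> complex) \<Rightarrow> complex \<Rightarrow> real \<Rightarrow> complex" where
  "goursat_transform H \<omega> x = (LBINT r:{0..x}. H (x - r) r * cos (\<omega> * of_real (x - 2 * r)))"

text \<open>The scaling \<open>r = z \<tau>\<close> replaces the variable upper limit by 1 and moves
  \<open>z\<close> into the integrand, where continuity of integrals with a parameter applies; it is
  valid at \<open>z = 0\<close> as well.\<close>

lemma continuous_on_goursat_transform:
  assumes H: "goursat_solution b q h H"
  shows "continuous_on {0..b} (goursat_transform H \<omega>)"
proof -
  let ?f = "\<lambda>z \<tau>. H (z - z * \<tau>) (z * \<tau>) * cos (\<omega> * of_real (z - 2 * (z * \<tau>)))"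
  have f: "continuous_on S (\<lambda>p. ?f (z p) (t p))"
    if "continuous_on S z" "continuous_on S t" "\<And>p. p \<in> S \<Longrightarrow> z p \<in> {0..b} \<and> t p \<in> {0..1}"
    for S :: "'x::t2_space set" and z t
  proof -
    have "z p * t p \<le> z p" "0 \<le> z p * t p" if "p \<in> S" for p
      using \<open>\<And>p. p \<in> S \<Longrightarrow> z p \<in> {0..b} \<and> t p \<in> {0..1}\<close>[OF that]
      by (auto simp: mult_left_le)
    then show ?thesis using that
      by (intro continuous_intros goursat_solution_continuous_on[OF H])
         (auto intro!: goursat_domainI)
  qed
  have "goursat_transform H \<omega> z = z *\<^sub>R integral (cbox 0 1) (?f z)" if z: "z \<in> {0..b}" for z
  proof -
    have "goursat_transform H \<omega> z
        = (LBINT r=ereal (z * 0)..ereal (z * 1). H (z - r) r * cos (\<omega> * of_real (z - 2 * r)))"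
      using z by (simp add: goursat_transform_def interval_integral_Icc flip: zero_ereal_def)
    also have "\<dots> = (LBINT \<tau>=ereal 0..ereal 1. z *\<^sub>R ?f z \<tau>)"
    proof (rule interval_integral_substitution_finite[symmetric, where g = "\<lambda>\<tau>. z * \<tau>"
            and f = "\<lambda>r. H (z - r) r * cos (\<omega> * of_real (z - 2 * r))"])
      have "continuous_on {0..z} (\<lambda>r. H (z - r) r * cos (\<omega> * of_real (z - 2 * r)))"
        using z by (intro continuous_intros goursat_solution_continuous_on[OF H])
          (auto intro!: goursat_domainI)
      then show "continuous_on ((\<lambda>\<tau>. z * \<tau>) ` {0..1}) (\<lambda>r. H (z - r) r * cos (\<omega> * of_real (z - 2 * r)))"
        by (rule continuous_on_subset) (use z in \<open>auto simp: mult_left_le\<close>)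
    qed (auto intro!: derivative_eq_intros)
    also have "\<dots> = z *\<^sub>R (LBINT \<tau>:{0..1}. ?f z \<tau>)"
      by (simp only: interval_integral_Icc zero_le_one set_integral_scaleR_right)
    also have "(LBINT \<tau>:{0..1}. ?f z \<tau>) = integral (cbox 0 1) (?f z)"
      using z f[of "{0..1}" "\<lambda>_. z" "\<lambda>t. t"]
      by (simp add: set_borel_integral_eq_integral borel_integrable_atLeastAtMost')
    finally show ?thesis .
  qed
  then show ?thesis
    by (subst continuous_on_cong[OF refl, of _ _ "\<lambda>z. z *\<^sub>R integral (cbox 0 1) (?f z)"], assumption)
       (intro continuous_intros integral_continuous_on_param, unfold case_prod_beta', rule f,
       auto intro!: continuous_intros)
qed

text \<open>\<open>H (x - v) v\<close> is split into \<open>h / 2\<close>, the increment from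
  \<open>h / 2\<close> to \<open>H (x - v) 0\<close>, and the increment from there to
  \<open>H (x - v) v\<close>. The three parts yield in turn the term with \<open>h\<close>, the
  integral with the cosine and the integral with the transform itself.\<close>

lemma goursat_transform_Volterra:
  assumes b: "b > 0" and q: "continuous_on {-b..b} q" and H: "goursat_solution b q h H"
    and x: "x \<in> {0..b}"
  shows "2 * goursat_transform H \<omega> x = h * sine_kernel \<omega> (of_real x)
     + (LBINT s:{0..x}. sine_kernel \<omega> (of_real (x - s)) * q s *
          (cos (\<omega> * of_real s) + 2 * goursat_transform H \<omega> s))"
proof -
  let ?S = "\<lambda>s. sine_kernel \<omega> (of_real s)"
  define k where "k v = cos (\<omega> * of_real (x - 2 * v))" for v
  have k_cont: "continuous_on S k" for S
    unfolding k_def by (intro continuous_intros)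
  then have [measurable]: "k \<in> borel_measurable borel"
    by (intro borel_measurable_continuous_onI)
  obtain Bk where Bk0: "0 \<le> Bk" and Bk: "\<And>v. v \<in> {0..x} \<Longrightarrow> norm (k v) \<le> Bk"
    using continuous_on_compact_norm_bound[OF compact_Icc k_cont] by metis
  have k_int: "(LBINT v:{r..x - s}. k v) = ?S (x - r - s) * cos (\<omega> * of_real (s - r))"
    if "r + s \<le> x" for r s
    using interval_integral_cos_chord[of r x s \<omega>] that by (simp add: interval_integral_Icc k_def)
  define T where "T = {p :: real \<times> real. 0 \<le> fst p \<and> 0 \<le> snd p \<and> fst p + snd p \<le> b}"
  have T_compact: "compact T"
  proof -
    have "closed T"
      unfolding T_def by (intro closed_Collect_conj closed_Collect_le continuous_intros)
    moreover have "bounded T"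
      by (rule bounded_subset[of "cbox (0, 0) (b, b)"]) (auto simp: T_def)
    ultimately show ?thesis by (simp add: compact_eq_bounded_closed)
  qed
  \<comment> \<open>\<open>q\<close> and \<open>H\<close> are controlled only on their domains.
    Truncation to the triangle \<open>T\<close> gives the global measurability and the bound needed
    for exchanging integrals; \<open>qq\<close> below is truncated for the same reason.\<close>
  define F where "F s r = indicator T (s, r) *\<^sub>R (q (s + r) * H s r)" for s r
  have F_cont: "continuous_on T (\<lambda>p. q (fst p + snd p) * H (fst p) (snd p))"
    using b by (intro continuous_on_mult goursat_solution_continuous_on[OF H] continuous_on_compose2[OF q])
      (auto intro!: continuous_intros goursat_domainI simp: T_def)
  have F_meas: "(\<lambda>(s, r). F s r) \<in> borel_measurable borel"
    using borel_measurable_continuous_on_indicator[OF _ F_cont] T_compact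
    by (simp add: F_def case_prod_beta' compact_imp_closed)
  then have [measurable]: "(\<lambda>(s, r). F s r) \<in> borel_measurable (borel \<Otimes>\<^sub>M borel)"
    by (simp add: borel_prod)
  obtain BF where BF0: "0 \<le> BF"
    and BF': "\<And>p. p \<in> T \<Longrightarrow> norm (q (fst p + snd p) * H (fst p) (snd p)) \<le> BF"
    using continuous_on_compact_norm_bound[OF T_compact F_cont] by metis
  have BF: "norm (F s r) \<le> BF" for s r
    using BF'[of "(s, r)"] BF0 by (simp add: F_def indicator_def)
  define qq where "qq s = indicator {0..b} s *\<^sub>R q s" for s
  have q_cont: "continuous_on {0..b} q" by (rule continuous_on_subset[OF q]) auto
  have [measurable]: "qq \<in> borel_measurable borel"
    unfolding qq_def by (rule borel_measurable_continuous_on_indicator[OF _ q_cont]) auto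
  obtain Bq where Bq0: "0 \<le> Bq" and Bq': "\<And>s. s \<in> {0..b} \<Longrightarrow> norm (q s) \<le> Bq"
    using continuous_on_compact_norm_bound[OF compact_Icc q_cont] by metis
  have Bq: "norm (qq s) \<le> Bq" for s
    using Bq'[of s] Bq0 by (simp add: qq_def indicator_def)
  let ?Q = "\<lambda>u. LBINT s:{0..u}. q s"
  let ?P = "\<lambda>u v. LBINT r:{0..v}. LBINT s:{0..u}. q (s + r) * H s r"
  note ieq = goursat_solution_integral_equation[OF b q H]
  \<comment> \<open>At \<open>v = 0\<close> the double integral of the integral equation runs over
    \<open>{0..0}\<close> and vanishes.\<close>
  have Q: "H u 0 - h / 2 = 1 / 2 * ?Q u" if "0 \<le> u" "u \<le> b" for u
    using ieq[of u 0] that interval_integral_Icc[of 0 0 "\<lambda>r. LBINT s:{0..u}. q (s + r) * H s r"] by simp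
  have P: "H u v - H u 0 = ?P u v" if "0 \<le> u" "0 \<le> v" "u + v \<le> b" for u v
  proof -
    have "H u v = h / 2 + 1 / 2 * ?Q u + ?P u v" using that by (intro ieq) auto
    also have "1 / 2 * ?Q u = H u 0 - h / 2" using that by (intro Q[symmetric]) auto
    finally show ?thesis by simp
  qed

  have T1: "(LBINT v:{0..x}. k v * (h / 2)) = h / 2 * ?S x"
    using k_int[of 0 0] x by simp

  have T2: "(LBINT v:{0..x}. k v * (H (x - v) 0 - h / 2))
      = 1 / 2 * (LBINT s:{0..x}. ?S (x - s) * q s * cos (\<omega> * of_real s))"
  proof -
    have "(LBINT v:{0..x}. k v * (H (x - v) 0 - h / 2))
        = (LBINT v:{0..x}. 1 / 2 * (LBINT s:{0..x - v}. k v * qq s))"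
    proof (rule set_lebesgue_integral_cong, simp, intro allI impI)
      fix v assume v: "v \<in> {0..x}"
      have "?Q (x - v) = (LBINT s:{0..x - v}. qq s)"
        by (rule set_lebesgue_integral_cong) (use v x in \<open>auto simp: qq_def\<close>)
      then show "k v * (H (x - v) 0 - h / 2) = 1 / 2 * (LBINT s:{0..x - v}. k v * qq s)"
        using Q[of "x - v"] v x by simp
    qed
    also have "\<dots> = 1 / 2 * (LBINT v:{0..x}. LBINT s:{0..x - v}. k v * qq s)"
      by (rule set_integral_mult_right)
    also have "(LBINT v:{0..x}. LBINT s:{0..x - v}. k v * qq s)
        = (LBINT s:{0..x - 0}. LBINT v:{0..x - s}. k v * qq s)"
      by (rule set_integral_swap_triangle_sum_le[where B="Bk * Bq"])
         (auto simp: norm_mult intro!: mult_mono Bk Bq Bk0)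
    also have "\<dots> = (LBINT s:{0..x}. ?S (x - s) * q s * cos (\<omega> * of_real s))"
      unfolding diff_zero by (rule set_lebesgue_integral_cong)
         (use x in \<open>auto simp: k_int[of 0] qq_def simp del: of_real_diff\<close>)
    finally show ?thesis .
  qed

  have T3: "(LBINT v:{0..x}. k v * (H (x - v) v - H (x - v) 0))
      = (LBINT s:{0..x}. ?S (x - s) * q s * goursat_transform H \<omega> s)"
  proof -
    have "(LBINT v:{0..x}. k v * (H (x - v) v - H (x - v) 0))
        = (LBINT v:{0..x}. LBINT r:{0..v}. k v * (LBINT s:{0..x - v}. F s r))"
    proof (rule set_lebesgue_integral_cong, simp, intro allI impI)
      fix v assume v: "v \<in> {0..x}"
      have "?P (x - v) v = (LBINT r:{0..v}. LBINT s:{0..x - v}. F s r)"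
        by (intro set_lebesgue_integral_cong allI impI) (use v x in \<open>auto simp: F_def T_def\<close>)
      then show "k v * (H (x - v) v - H (x - v) 0) = (LBINT r:{0..v}. k v * (LBINT s:{0..x - v}. F s r))"
        using P[of "x - v" v] v x by simp
    qed
    \<comment> \<open>The order \<open>v, r, s\<close> becomes \<open>r, v, s\<close> here and
      \<open>r, s, v\<close> after a second exchange. Only \<open>k\<close> depends on
      \<open>v\<close>, so the innermost integral is then the chord integral.\<close>
    also have "\<dots> = (LBINT r:{0..x}. LBINT v:{r..x}. k v * (LBINT s:{0..x - v}. F s r))"
    proof (rule set_integral_swap_triangle_le[where B="Bk * (BF * b)"])
      show "(\<lambda>(v, r). k v * (LBINT s:{0..x - v}. F s r)) \<in> borel_measurable (lborel \<Otimes>\<^sub>M lborel)"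
        unfolding set_lebesgue_integral_def indicator_def of_bool_def atLeastAtMost_iff by measurable
    next
      fix v r assume v: "0 \<le> r" "r \<le> v" "v \<le> x"
      have "norm (LBINT s:{0..x - v}. F s r) \<le> BF * (x - v - 0)"
        using v by (intro norm_set_integral_Icc_le BF BF0) auto
      also have "\<dots> \<le> BF * b" using v x BF0 by (intro mult_left_mono) auto
      finally show "norm (k v * (LBINT s:{0..x - v}. F s r)) \<le> Bk * (BF * b)"
        using v Bk0 by (simp only: norm_mult) (auto intro!: mult_mono Bk)
    qed
    also have "\<dots> = (LBINT r:{0..x}. LBINT v:{r..x}. LBINT s:{0..x - v}. k v * F s r)"
      by simp
    also have "\<dots> = (LBINT r:{0..x}. LBINT s:{0..x - r}. LBINT v:{r..x - s}. k v * F s r)"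
      by (intro set_lebesgue_integral_cong allI impI set_integral_swap_triangle_sum_le[where B="Bk * BF"])
         (auto simp: norm_mult intro!: mult_mono Bk BF Bk0)
    also have "\<dots> = (LBINT r:{0..x}. LBINT s:{0..x - r}. ?S (x - (s + r)) * (cos (\<omega> * of_real (s - r)) * F s r))"
      by (intro set_lebesgue_integral_cong allI impI)
         (auto simp: k_int simp del: of_real_diff intro!: arg_cong[where f="\<lambda>t. sine_kernel \<omega> (of_real t)"])
    \<comment> \<open>With \<open>z = s + r\<close> the sine kernel and \<open>q\<close> depend on
      \<open>z\<close> alone. Once \<open>z\<close> is the outer variable, what remains inside is
      the transform at \<open>z\<close>.\<close>
    also have "\<dots> = (LBINT r:{0..x}. LBINT z:{r..x}. ?S (x - z) * (cos (\<omega> * of_real (z - 2 * r)) * F (z - r) r))"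
      by (subst set_integral_shift) (simp add: algebra_simps)
    also have "\<dots> = (LBINT z:{0..x}. LBINT r:{0..z}. ?S (x - z) * (cos (\<omega> * of_real (z - 2 * r)) * F (z - r) r))"
    proof -
      have "continuous_on ({0..x} \<times> {0..x}) (\<lambda>p. ?S (x - fst p) * cos (\<omega> * of_real (fst p - 2 * snd p)))"
        by (intro continuous_intros)
      from continuous_on_compact_norm_bound[OF compact_Times[OF compact_Icc compact_Icc] this]
      obtain B where B0: "0 \<le> B" and B': "\<And>p. p \<in> {0..x} \<times> {0..x} \<Longrightarrow>
          norm (?S (x - fst p) * cos (\<omega> * of_real (fst p - 2 * snd p))) \<le> B" by metis
      have B: "norm (?S (x - z) * cos (\<omega> * of_real (z - 2 * r))) \<le> B" if "z \<in> {0..x}" "r \<in> {0..x}" for z r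
        using B'[of "(z, r)"] that by simp
      show ?thesis
        by (rule set_integral_swap_triangle_le[symmetric, where B="B * BF"])
           (auto simp del: of_real_diff simp: norm_mult simp flip: mult.assoc
             intro!: mult_mono B[unfolded norm_mult] BF B0)
    qed
    also have "\<dots> = (LBINT z:{0..x}. ?S (x - z) * q z * goursat_transform H \<omega> z)"
    proof (rule set_lebesgue_integral_cong, simp, intro allI impI)
      fix z assume z: "z \<in> {0..x}"
      have "(LBINT r:{0..z}. cos (\<omega> * of_real (z - 2 * r)) * F (z - r) r)
          = (LBINT r:{0..z}. q z * (H (z - r) r * cos (\<omega> * of_real (z - 2 * r))))"
        by (intro set_lebesgue_integral_cong allI impI) (use z x in \<open>auto simp: F_def T_def\<close>)
      then show "(LBINT r:{0..z}. ?S (x - z) * (cos (\<omega> * of_real (z - 2 * r)) * F (z - r) r))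
          = ?S (x - z) * q z * goursat_transform H \<omega> z"
        by (simp add: goursat_transform_def)
    qed
    finally show ?thesis .
  qed

  have Hx: "continuous_on {0..x} (\<lambda>v. H (x - v) v)" "continuous_on {0..x} (\<lambda>v. H (x - v) 0)"
    using x by (auto intro!: goursat_solution_continuous_on[OF H] continuous_intros goursat_domainI)
  note int = borel_integrable_atLeastAtMost'
  have "goursat_transform H \<omega> x = (LBINT v:{0..x}.
      k v * (h / 2) + (k v * (H (x - v) 0 - h / 2) + k v * (H (x - v) v - H (x - v) 0)))"
    unfolding goursat_transform_def k_def by (simp add: algebra_simps)
  also have "\<dots> = h / 2 * ?S x + (1 / 2 * (LBINT s:{0..x}. ?S (x - s) * q s * cos (\<omega> * of_real s))
      + (LBINT s:{0..x}. ?S (x - s) * q s * goursat_transform H \<omega> s))"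
    by (subst set_integral_add, (intro int continuous_intros k_cont Hx)+,
        subst set_integral_add, (intro int continuous_intros k_cont Hx)+) (simp only: T1 T2 T3)
  finally have 1: "2 * goursat_transform H \<omega> x = h * ?S x
      + ((LBINT s:{0..x}. ?S (x - s) * q s * cos (\<omega> * of_real s))
        + (LBINT s:{0..x}. 2 * (?S (x - s) * q s * goursat_transform H \<omega> s)))"
    by (simp only: set_integral_mult_right) (simp add: field_simps)
  have q_cont': "continuous_on {0..x} q" and W: "continuous_on {0..x} (goursat_transform H \<omega>)"
    by (rule continuous_on_subset[OF q_cont], use x in auto)
       (rule continuous_on_subset[OF continuous_on_goursat_transform[OF H]], use x in auto)
  show ?thesis unfolding 1
    by (subst set_integral_add(2)[symmetric], (intro int continuous_intros q_cont' W)+)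
       (simp add: algebra_simps)
qed

section \<open>The Volterra equation of the solution \<open>c\<close> and its integral
  representation\<close>

text \<open>The variation of constants expression is integrated from 0 to \<open>x\<close>. At
  \<open>s = x\<close> it equals \<open>c x\<close>, because the sine kernel vanishes and the cosine
  is 1; at \<open>s = 0\<close> the initial values give the solution for zero potential.\<close>

lemma schroedinger_solution_Volterra:
  assumes b: "b > 0" and q: "continuous_on {-b..b} q"
    and c: "schroedinger_solution b q (\<omega>\<^sup>2) c" "c 0 = 1" "vector_derivative c (at 0) = h"
    and x: "x \<in> {0..b}"
  shows "c x = cos (\<omega> * of_real x) + h * sine_kernel \<omega> (of_real x)
     + (LBINT s:{0..x}. sine_kernel \<omega> (of_real (x - s)) * q s * c s)"
proof -
  from c(1) obtain c' c'' where
    c': "\<And>x. x \<in> {-b..b} \<Longrightarrow> (c has_vector_derivative c' x) (at x within {-b..b})"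
    and c'': "\<And>x. x \<in> {-b..b} \<Longrightarrow> (c' has_vector_derivative c'' x) (at x within {-b..b})"
    and eq: "\<And>x. x \<in> {-b..b} \<Longrightarrow> c'' x - q x * c x + \<omega>\<^sup>2 * c x = 0"
    unfolding schroedinger_solution_def by blast
  \<comment> \<open>The initial slope is an unrestricted derivative, while the solution is
    differentiated within \<open>[-b,b]\<close>; the two agree because 0 is an interior
    point.\<close>
  have "at (0::real) within {-b..b} = at 0"
    using b by (intro at_within_interior) simp
  then have h: "c' 0 = h"
    using c'[of 0] c(3) b by (simp add: vector_derivative_at)
  have cont: "continuous_on {0..x} c"
    using x by (intro continuous_on_subset[OF continuous_on_vector_derivative[of "{-b..b}" c c']] c') auto
  define g where "g s = sine_kernel \<omega> (of_real (x - s)) * c' s + cos (\<omega> * of_real (x - s)) * c s" for s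
  have "(LBINT s=ereal 0..ereal x. sine_kernel \<omega> (of_real (x - s)) * q s * c s) = g x - g 0"
  proof (rule interval_integral_FTC_finite)
    show "continuous_on {min 0 x..max 0 x} (\<lambda>s. sine_kernel \<omega> (of_real (x - s)) * q s * c s)"
      using x cont by (auto intro!: continuous_intros continuous_on_subset[OF q])
    fix s assume s: "min 0 x \<le> s" "s \<le> max 0 x"
    then have s': "s \<in> {-b..b}" "{min 0 x..max 0 x} \<subseteq> {-b..b}" using x by auto
    have "(g has_vector_derivative sine_kernel \<omega> (of_real (x - s)) * (c'' s + \<omega>\<^sup>2 * c s)) (at s within {-b..b})"
      unfolding g_def by (rule sine_kernel_Volterra_derivative[OF c' c'']) (use s' in auto)
    moreover have "c'' s + \<omega>\<^sup>2 * c s = q s * c s"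
      using eq[OF s'(1)] by (simp add: algebra_simps)
    ultimately show "(g has_vector_derivative sine_kernel \<omega> (of_real (x - s)) * q s * c s)
        (at s within {min 0 x..max 0 x})"
      using has_vector_derivative_within_subset[OF _ s'(2)] by (simp only: mult.assoc)
  qed
  then show ?thesis
    using x c(2) by (simp add: interval_integral_Icc g_def h algebra_simps)
qed

lemma schroedinger_solution_eq_goursat_transform:
  assumes b: "b > 0" and q: "continuous_on {-b..b} q" and H: "goursat_solution b q h H"
    and c: "schroedinger_solution b q (\<omega>\<^sup>2) c" "c 0 = 1" "vector_derivative c (at 0) = h"
    and x: "x \<in> {0..b}"
  shows "c x = cos (\<omega> * of_real x) + 2 * goursat_transform H \<omega> x"
proof -
  let ?y = "\<lambda>x. cos (\<omega> * of_real x) + 2 * goursat_transform H \<omega> x"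
  let ?K = "\<lambda>x s. sine_kernel \<omega> (of_real (x - s)) * q s"
  have q0: "continuous_on {0..b} q" by (rule continuous_on_subset[OF q]) auto
  have y_cont: "continuous_on {0..b} ?y"
    by (intro continuous_intros continuous_on_goursat_transform[OF H])
  have c_cont: "continuous_on {0..b} c"
  proof -
    obtain c' where "\<And>x. x \<in> {-b..b} \<Longrightarrow> (c has_vector_derivative c' x) (at x within {-b..b})"
      using c(1) unfolding schroedinger_solution_def by blast
    then have "continuous_on {-b..b} c" by (rule continuous_on_vector_derivative)
    then show ?thesis by (rule continuous_on_subset) auto
  qed
  have "continuous_on ({0..b} \<times> {0..b}) (\<lambda>p. ?K (fst p) (snd p))"
    by (intro continuous_intros continuous_on_compose2[OF q0]) auto
  from continuous_on_compact_norm_bound[OF compact_Times[OF compact_Icc compact_Icc] this]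
  obtain M where M: "\<And>p. p \<in> {0..b} \<times> {0..b} \<Longrightarrow> norm (?K (fst p) (snd p)) \<le> M" by metis
  have "c x - ?y x = 0"
  proof (rule Volterra_uniqueness[where K = ?K and b = b and M = M])
    show "continuous_on {0..b} (\<lambda>x. c x - ?y x)" by (intro continuous_intros c_cont y_cont)
    show "norm (?K x s) \<le> M" if "0 \<le> s" "s \<le> x" "x \<le> b" for x s
      using M[of "(x, s)"] that by auto
    fix x assume x: "x \<in> {0..b}"
    have "set_integrable lborel {0..x} (\<lambda>s. ?K x s * c s)" "set_integrable lborel {0..x} (\<lambda>s. ?K x s * ?y s)"
      using x by (auto intro!: borel_integrable_atLeastAtMost' continuous_intros
        continuous_on_subset[OF q0] continuous_on_subset[OF c_cont]
        continuous_on_subset[OF continuous_on_goursat_transform[OF H]])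
    from set_integral_diff(2)[OF this]
    show "c x - ?y x = (LBINT s:{0..x}. ?K x s * (c s - ?y s))"
      unfolding schroedinger_solution_Volterra[OF b q c x] goursat_transform_Volterra[OF b q H x]
      by (simp add: right_diff_distrib)
  qed (use b x in auto)
  then show ?thesis by simp
qed

section \<open>The cosine integral of the kernel in characteristic coordinates\<close>

lemma continuous_on_kernel_C:
  assumes H: "goursat_solution b q h H" and x: "x \<in> {0..b}"
  shows "continuous_on {0..x} (\<lambda>t. kernel_C H x t)"
  unfolding kernel_C_def kernel_K_def using x
  by (intro continuous_intros goursat_solution_continuous_on[OF H]) (auto simp: field_simps intro!: goursat_domainI)

text \<open>The term \<open>kernel_K H x t\<close> sweeps the half \<open>v <= x / 2\<close> of the
  chord and \<open>kernel_K H x (- t)\<close> the half \<open>v >= x / 2\<close>; since the cosine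
  is even, the same integrand \<open>f\<close> serves both.\<close>

lemma kernel_C_cos_integral:
  assumes H: "goursat_solution b q h H" and x: "x \<in> {0..b}"
  shows "(LBINT t:{0..x}. kernel_C H x t * cos (\<omega> * of_real t)) = 2 * goursat_transform H \<omega> x"
proof -
  define f where "f v = H (x - v) v * cos (\<omega> * of_real (x - 2 * v))" for v
  have f: "continuous_on A f" if "A \<subseteq> {0..x}" for A
    unfolding f_def using x that
    by (intro continuous_intros goursat_solution_continuous_on[OF H]) (auto intro!: goursat_domainI)
  have lower: "(LBINT t:{0..x}. f ((x - t) / 2)) = 2 * (LBINT v:{0..x / 2}. f v)"
  proof -
    \<comment> \<open>The factor is the derivative of \<open>(x - t) / 2\<close>; its sign is undone
      by the reversed end points after the substitution.\<close>
    have "(- (1 / 2)) *\<^sub>R (LBINT t:{0..x}. f ((x - t) / 2))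
        = (LBINT t=ereal 0..ereal x. (- (1 / 2)) *\<^sub>R f ((x - t) / 2))"
      using x by (simp only: interval_integral_Icc set_integral_scaleR_right atLeastAtMost_iff)
    also have "\<dots> = (LBINT v=ereal ((x - 0) / 2)..ereal ((x - x) / 2). f v)"
      using x by (intro interval_integral_substitution_finite f)
        (auto intro!: continuous_intros derivative_eq_intros)
    also have "\<dots> = - (LBINT v:{0..x / 2}. f v)"
      using x interval_integral_endpoints_reverse[of "ereal (x / 2)" "ereal 0" f]
      by (simp add: interval_integral_Icc)
    finally show ?thesis by (simp add: scaleR_conv_of_real)
  qed
  have upper: "(LBINT t:{0..x}. f ((x + t) / 2)) = 2 * (LBINT v:{x / 2..x}. f v)"
  proof -
    have "(1 / 2) *\<^sub>R (LBINT t:{0..x}. f ((x + t) / 2))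
        = (LBINT t=ereal 0..ereal x. (1 / 2) *\<^sub>R f ((x + t) / 2))"
      using x by (simp only: interval_integral_Icc set_integral_scaleR_right atLeastAtMost_iff)
    also have "\<dots> = (LBINT v=ereal ((x + 0) / 2)..ereal ((x + x) / 2). f v)"
      using x by (intro interval_integral_substitution_finite f)
        (auto intro!: continuous_intros derivative_eq_intros)
    also have "\<dots> = (LBINT v:{x / 2..x}. f v)"
      using x by (simp add: interval_integral_Icc)
    finally show ?thesis by (simp add: scaleR_conv_of_real)
  qed
  have "(LBINT t:{0..x}. kernel_C H x t * cos (\<omega> * of_real t))
      = (LBINT t:{0..x}. f ((x - t) / 2) + f ((x + t) / 2))"
  proof (rule set_lebesgue_integral_cong, simp, intro allI impI)
    fix t
    have "x - (x - t) / 2 = (x + t) / 2" "x - (x + t) / 2 = (x - t) / 2"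
      "x - 2 * ((x - t) / 2) = t" "x - 2 * ((x + t) / 2) = - t"
      by (auto simp: field_simps)
    then show "kernel_C H x t * cos (\<omega> * of_real t) = f ((x - t) / 2) + f ((x + t) / 2)"
      by (simp only: kernel_C_def kernel_K_def f_def) (simp add: algebra_simps)
  qed
  also have "\<dots> = (LBINT t:{0..x}. f ((x - t) / 2)) + (LBINT t:{0..x}. f ((x + t) / 2))"
    using x by (intro set_integral_add borel_integrable_atLeastAtMost'
        continuous_on_compose2[OF f[OF order.refl]]) (auto intro!: continuous_intros)
  also have "\<dots> = 2 * ((LBINT v=ereal 0..ereal (x / 2). f v) + (LBINT v=ereal (x / 2)..ereal x. f v))"
    using x by (simp add: lower upper interval_integral_Icc distrib_left)
  also have "(LBINT v=ereal 0..ereal (x / 2). f v) + (LBINT v=ereal (x / 2)..ereal x. f v)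
      = (LBINT v=ereal 0..ereal x. f v)"
    using x f[of "{0..x}"]
    by (intro interval_integral_sum)
       (auto simp: min_def max_def intro!: interval_integrable_continuous_on)
  also have "(LBINT v=ereal 0..ereal x. f v) = goursat_transform H \<omega> x"
    using x by (simp add: interval_integral_Icc goursat_transform_def f_def)
  finally show ?thesis .
qed

section \<open>The error estimate in the strip\<close>

lemma norm_cos_le_cosh_Im:
  fixes z :: complex
  shows "norm (cos z) \<le> cosh (Im z)"
proof -
  have "norm (cos z) = norm (exp (\<i> * z) + exp (- (\<i> * z))) / 2"
    by (simp add: cos_exp_eq norm_divide)
  also have "\<dots> \<le> (exp (- Im z) + exp (Im z)) / 2"
    using norm_triangle_ineq[of "exp (\<i> * z)" "exp (- (\<i> * z))"] by simp
  finally show ?thesis by (simp add: cosh_def)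
qed

lemma norm_kernel_integral_le:
  fixes k :: "real \<Rightarrow> complex"
  assumes x: "0 \<le> x" and C: "C > 0" "\<bar>Im \<omega>\<bar> \<le> C"
    and k: "\<And>t. t \<in> {0..x} \<Longrightarrow> norm (k t) \<le> \<epsilon>"
  shows "norm (LBINT t:{0..x}. k t * cos (\<omega> * of_real t)) \<le> \<epsilon> * (sinh (C * x) / C)"
proof -
  \<comment> \<open>The sign of \<open>\<epsilon>\<close> comes from the bound on \<open>k\<close>
    at \<open>t = 0\<close>, a point of the interval for every admissible \<open>x\<close>.\<close>
  have \<epsilon>: "0 \<le> \<epsilon>" using order.trans[OF norm_ge_zero k[of 0]] x by simp
  have "norm (LBINT t:{0..x}. k t * cos (\<omega> * of_real t))
      \<le> (LBINT t. norm (indicator {0..x} t *\<^sub>R (k t * cos (\<omega> * of_real t))))"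
    unfolding set_lebesgue_integral_def by (rule integral_norm_bound)
  also have "\<dots> \<le> (LBINT t:{0..x}. \<epsilon> * cosh (C * t))"
    unfolding set_lebesgue_integral_def
  proof (rule integral_mono')
    show "integrable lborel (\<lambda>t. indicator {0..x} t *\<^sub>R (\<epsilon> * cosh (C * t)))"
      by (intro borel_integrable_compact compact_Icc continuous_intros)
  next
    fix t
    show "0 \<le> indicator {0..x} t *\<^sub>R (\<epsilon> * cosh (C * t))"
      using \<epsilon> by (simp add: indicator_def)
    show "norm (indicator {0..x} t *\<^sub>R (k t * cos (\<omega> * of_real t))) \<le> indicator {0..x} t *\<^sub>R (\<epsilon> * cosh (C * t))"
    proof (cases "t \<in> {0..x}")
      case True
      have "norm (cos (\<omega> * of_real t)) \<le> cosh (Im \<omega> * t)"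
        using norm_cos_le_cosh_Im[of "\<omega> * of_real t"] by simp
      \<comment> \<open>\<open>cosh\<close> is monotone only on nonnegative arguments, so its
        evenness is used before comparing with \<open>C * t\<close>.\<close>
      also have "\<dots> = cosh \<bar>Im \<omega> * t\<bar>" by (simp add: abs_if)
      also have "\<dots> \<le> cosh (C * t)"
        using True C by (subst cosh_real_nonneg_le_iff) (auto simp: abs_mult intro!: mult_right_mono)
      finally show ?thesis
        using True k[OF True] \<epsilon> by (auto simp: norm_mult intro!: mult_mono)
    qed simp
  qed
  also have "\<dots> = (LBINT t=ereal 0..ereal x. \<epsilon> * cosh (C * t))"
    using x by (simp add: interval_integral_Icc)
  also have "\<dots> = \<epsilon> * (sinh (C * x) / C) - \<epsilon> * (sinh (C * 0) / C)"
    using C(1) by (intro interval_integral_FTC_finite)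
      (auto intro!: continuous_intros derivative_eq_intros simp flip: has_real_derivative_iff_has_vector_derivative)
  finally show ?thesis by simp
qed

text \<open>For fixed \<open>x\<close> this is a polynomial in \<open>t\<close>; the formal powers
  enter only as coefficients.\<close>

lemma continuous_on_approx_C: "continuous_on A (\<lambda>t. approx_C f a N x t)"
  unfolding approx_C_def wave_poly_0_def wave_poly_odd_def by (intro continuous_intros)

theorem proposition6p2:
  fixes b C \<epsilon> :: real and q f c :: "real \<Rightarrow> complex" and h \<omega> :: complex
    and H :: "real \<Rightarrow> real \<Rightarrow> complex" and a :: "nat \<Rightarrow> complex" and N :: nat
  assumes "b > 0"
    and "continuous_on {-b..b} q"
    and "schroedinger_solution b q 0 f"
    and "\<forall>x\<in>{-b..b}. f x \<noteq> 0"
    and "f 0 = 1"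
    and "h = vector_derivative f (at 0)"
    and "goursat_solution b q h H"
    and "schroedinger_solution b q (\<omega>\<^sup>2) c"
    and "c 0 = 1"
    and "vector_derivative c (at 0) = h"
    and "C > 0"
    and "\<bar>Im \<omega>\<bar> \<le> C"
    and "\<forall>x\<in>{-b..b}. \<forall>t\<in>{-b..b}. cmod (kernel_C H x t - approx_C f a N x t) \<le> \<epsilon>"
  shows "\<forall>x\<in>{0..b}. cmod (c x - approx_c f a N \<omega> x) \<le> \<epsilon> * (sinh (C * x) / C)"
proof
  fix x assume x: "x \<in> {0..b}"
  have "set_integrable lborel {0..x} (\<lambda>t. kernel_C H x t * cos (\<omega> * of_real t))"
    "set_integrable lborel {0..x} (\<lambda>t. approx_C f a N x t * cos (\<omega> * of_real t))"
    by (intro borel_integrable_atLeastAtMost' continuous_intros continuous_on_approx_C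
        continuous_on_kernel_C[OF assms(7) x])+
  note diff = set_integral_diff(2)[OF this]
  have "(LBINT t=0..x. approx_C f a N x t * cos (\<omega> * of_real t))
      = (LBINT t:{0..x}. approx_C f a N x t * cos (\<omega> * of_real t))"
    using x by (simp add: interval_integral_Icc zero_ereal_def)
  \<comment> \<open>The leading cosines of the two representations cancel, which leaves the kernel
    difference at points with \<open>0 <= t <= x <= b\<close>, all inside the square of the
    hypothesis.\<close>
  then have "c x - approx_c f a N \<omega> x
      = (LBINT t:{0..x}. (kernel_C H x t - approx_C f a N x t) * cos (\<omega> * of_real t))"
    using diff schroedinger_solution_eq_goursat_transform[OF assms(1,2,7-10) x]
      kernel_C_cos_integral[OF assms(7) x, of \<omega>]
    by (simp add: approx_c_def left_diff_distrib)
  then show "cmod (c x - approx_c f a N \<omega> x) \<le> \<epsilon> * (sinh (C * x) / C)"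
    using norm_kernel_integral_le[of x C \<omega> "\<lambda>t. kernel_C H x t - approx_C f a N x t" \<epsilon>] x assms(11-13)
    by auto
qed

end
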